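(* Let $(X,d)$ be a complete metric space and let $F\colon X\to 2^{X}$ be a mapping all of whose values are closed. Assume that for every sequence $(x_n)_{n\in\mathbb{N}}$ in $X$ converging to some $x\in X$, if $\lim_{n\to\infty} d(F(x_n),x_n)=0$, then $d(F(x),x)=0$ (this holds, for example, if the graph of $F$ is closed). Assume further that there are $\alpha\ge 0$, $\epsilon\ge 0$ with $\alpha+\epsilon<1$ such that for each $x\in X$ there exists a $y\in F(x)$ with $$d(F(y),y)\le \alpha\, d(y,x)\le (\alpha+\epsilon)\, d(F(x),x).$$ Then $F$ has a fixed point.
   Context: $2^{X}$ is the family of all subsets of $X$. A (multivalued) mapping $F\colon X\to 2^{X}$ is understood to satisfy $X\neq\emptyset$ and $F(x)\neq\emptyset$ for all $x\in X$. For a nonempty set $A$, $d(A,x)=d(x,A)=\inf_{a\in A}d(a,x)$. The graph of $F$ is $\{(x,y)\colon x\in X,\ y\in F(x)\}$. A fixed point of $F$ is an $x\in X$ with $x\in F(x)$. *)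

theory Defs
  imports "HOL-Analysis.Analysis"
begin

definition mv_graph :: "('a \<Rightarrow> 'b set) \<Rightarrow> ('a \<times> 'b) set" where
  "mv_graph F = {(x, y). y \<in> F x}"

text \<open>For nonempty \<open>A\<close>, the distance of the point \<open>x\<close> to \<open>A\<close> is the library's \<open>infdist x A\<close>;
  its convention for the empty set plays no role, since all values of \<open>F\<close> are assumed nonempty.\<close>

definition infdist_limit_condition :: "('a::metric_space \<Rightarrow> 'a set) \<Rightarrow> bool" where
  "infdist_limit_condition F \<longleftrightarrow>
     (\<forall>(u :: nat \<Rightarrow> 'a) x. u \<longlonglongrightarrow> x \<longrightarrow> (\<lambda>n. infdist (u n) (F (u n))) \<longlonglongrightarrow> 0 \<longrightarrow>
        infdist x (F x) = 0)"

definition fixed_point :: "('a \<Rightarrow> 'a set) \<Rightarrow> 'a \<Rightarrow> bool" where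
  "fixed_point F x \<longleftrightarrow> x \<in> F x"

end

theory Submission
  imports Defs
begin

text \<open>
  Write \<open>\<delta> x\<close> for \<open>infdist x (F x)\<close>. As the values of \<open>F\<close> are closed, a fixed point is the
  same as a zero of \<open>\<delta>\<close>. The two inequalities in the hypothesis let one walk towards such a zero: moving
  from \<open>x\<close> to the point \<open>y \<in> F x\<close> they supply, \<open>\<delta>\<close> shrinks by the factor
  \<open>c = \<alpha> + \<epsilon> < 1\<close>, and, if \<open>\<alpha> > 0\<close>, the length of the step is at most \<open>c / \<alpha>\<close> times the
  current value of \<open>\<delta>\<close>. Hence along the orbit both \<open>\<delta>\<close> and the step lengths decay
  geometrically, the orbit is Cauchy by \<open>Cauchy_if_dist_Suc_le_summable\<close>, and the limit condition
  turns the convergence of \<open>\<delta>\<close> to \<open>0\<close> along the orbit into \<open>\<delta> = 0\<close> at its limit. For \<open>\<alpha> = 0\<close> there is no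
  control over the step length, but a single step already reaches a zero of \<open>\<delta>\<close>.

  A closed graph gives the limit condition because almost nearest points \<open>v n \<in> F (u n)\<close> then
  converge to the same limit as \<open>u\<close>, which puts the limit of the pairs \<open>(u n, v n)\<close> on the
  diagonal and in the graph.
\<close>

text \<open>The distance between two terms is at most the difference of the partial sums of \<open>b\<close>, and
  those partial sums form a Cauchy sequence.\<close>

lemma Cauchy_if_dist_Suc_le_summable:
  fixes x :: "nat \<Rightarrow> 'a::metric_space"
  assumes step: "\<And>n. dist (x (Suc n)) (x n) \<le> b n" and "summable b"
  shows "Cauchy x"
proof -
  define s where "s n = (\<Sum>k<n. b k)" for n
  have telescope: "dist (x n) (x m) \<le> s n - s m" if "m \<le> n" for m n
    using that
  proof (induction n rule: dec_induct)
    case (step k)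
    then show ?case
      using assms(1)[of k] dist_triangle[of "x (Suc k)" "x m" "x k"] by (simp add: s_def)
  qed simp
  have "Cauchy s"
    unfolding s_def using \<open>summable b\<close> by (simp add: summable_iff_convergent Cauchy_convergent_iff)
  show ?thesis
    unfolding Cauchy_altdef2
  proof (intro allI impI)
    fix e :: real
    assume "e > 0"
    then obtain N where N: "\<And>n. n \<ge> N \<Longrightarrow> dist (s n) (s N) < e"
      using \<open>Cauchy s\<close> unfolding Cauchy_altdef2 by blast
    have "dist (x n) (x N) < e" if "n \<ge> N" for n
      using telescope[OF that] N[OF that] by (simp add: dist_real_def)
    then show "\<exists>N. \<forall>n\<ge>N. dist (x n) (x N) < e"
      by blast
  qed
qed

lemma infdist_less_obtains:
  assumes "A \<noteq> {}" and "infdist x A < r"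
  obtains a where "a \<in> A" "dist x a < r"
proof -
  have "\<exists>a\<in>A. dist x a < r"
    using assms cINF_less_iff[OF \<open>A \<noteq> {}\<close> bdd_below_image_dist] by (simp add: infdist_notempty)
  then show thesis
    using that by blast
qed

lemma closed_graph_imp_infdist_limit_condition:
  fixes F :: "'a::metric_space \<Rightarrow> 'a set"
  assumes nonempty: "\<And>x. F x \<noteq> {}" and "closed (mv_graph F)"
  shows "infdist_limit_condition F"
  unfolding infdist_limit_condition_def
proof (intro allI impI)
  fix u :: "nat \<Rightarrow> 'a" and x
  assume u: "u \<longlonglongrightarrow> x" and d: "(\<lambda>n. infdist (u n) (F (u n))) \<longlonglongrightarrow> 0"
  \<comment> \<open>Nearest points need not exist, hence the slack \<open>inverse (Suc n)\<close>, which vanishes in the limit.\<close>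
  let ?r = "\<lambda>n. infdist (u n) (F (u n)) + inverse (real (Suc n))"
  have "\<exists>v. v \<in> F (u n) \<and> dist (u n) v < ?r n" for n
    by (rule infdist_less_obtains[OF nonempty, of "u n" "u n" "?r n"]) auto
  then obtain v where v: "\<And>n. v n \<in> F (u n)" "\<And>n. dist (u n) (v n) < ?r n"
    by metis
  have r: "?r \<longlonglongrightarrow> 0"
    using tendsto_add[OF d LIMSEQ_inverse_real_of_nat] by simp
  have near: "dist (v n) x \<le> ?r n + dist (u n) x" for n
    using v(2)[of n] dist_triangle3[of "v n" x "u n"] by linarith
  have lim: "(\<lambda>n. ?r n + dist (u n) x) \<longlonglongrightarrow> 0"
    using tendsto_add[OF r u[THEN tendsto_dist_iff[THEN iffD1]]] by simp
  have "v \<longlonglongrightarrow> x"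
    unfolding tendsto_dist_iff[of v]
    by (rule tendsto_sandwich[OF _ _ tendsto_const lim]) (use near in auto)
  have "(x, x) \<in> mv_graph F"
    by (rule closed_sequentially[OF \<open>closed (mv_graph F)\<close> _ tendsto_Pair[OF u \<open>v \<longlonglongrightarrow> x\<close>]])
      (simp add: mv_graph_def v(1))
  then show "infdist x (F x) = 0"
    by (simp add: mv_graph_def)
qed

text \<open>Iterating a choice of \<open>y\<close> makes \<open>\<delta>\<close> decay like \<open>c ^ n\<close>; the bound of the step length
  by \<open>K * \<delta> x\<close> passes this decay on to the steps, so the orbit is Cauchy. As \<open>\<delta>\<close> need not be
  semicontinuous, nothing can be concluded here about its value at the limit of the orbit.\<close>

lemma geometric_descent_converges:
  fixes \<delta> :: "'a::complete_space \<Rightarrow> real"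
  assumes c: "0 \<le> c" "c < 1" and K: "0 \<le> K"
    and nonneg: "\<And>x. 0 \<le> \<delta> x"
    and descent: "\<And>x. \<exists>y. \<delta> y \<le> c * \<delta> x \<and> dist y x \<le> K * \<delta> x"
  obtains u :: "nat \<Rightarrow> 'a" and x where "u \<longlonglongrightarrow> x" "(\<lambda>n. \<delta> (u n)) \<longlonglongrightarrow> 0"
proof -
  obtain g where g: "\<And>x. \<delta> (g x) \<le> c * \<delta> x" "\<And>x. dist (g x) x \<le> K * \<delta> x"
    using descent by metis
  fix a :: 'a
  define u where "u n = (g ^^ n) a" for n
  have u_Suc: "u (Suc n) = g (u n)" for n
    by (simp add: u_def)
  have bound: "\<delta> (u n) \<le> c ^ n * \<delta> a" for n
  proof (induction n)
    case (Suc n)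
    have "\<delta> (u (Suc n)) \<le> c * \<delta> (u n)"
      using g(1) by (simp add: u_Suc)
    also have "\<dots> \<le> c * (c ^ n * \<delta> a)"
      using Suc c by (intro mult_left_mono)
    finally show ?case
      by (simp add: mult.assoc)
  qed (simp add: u_def)
  have "dist (u (Suc n)) (u n) \<le> K * (c ^ n * \<delta> a)" for n
    using g(2)[of "u n"] mult_left_mono[OF bound K, of n] by (simp add: u_Suc)
  moreover have "summable (\<lambda>n. K * (c ^ n * \<delta> a))"
    using c by (intro summable_mult summable_mult2 summable_geometric) simp
  ultimately have "Cauchy u"
    by (rule Cauchy_if_dist_Suc_le_summable)
  then obtain x where "u \<longlonglongrightarrow> x"
    using Cauchy_convergent convergent_def by blast
  moreover have "(\<lambda>n. c ^ n * \<delta> a) \<longlonglongrightarrow> 0"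
    using c by (intro tendsto_mult_left_zero LIMSEQ_realpow_zero)
  then have "(\<lambda>n. \<delta> (u n)) \<longlonglongrightarrow> 0"
    by (rule tendsto_sandwich[OF _ _ tendsto_const, rotated 2])
      (auto intro!: always_eventually bound nonneg)
  ultimately show thesis
    by (rule that)
qed

lemma infdist_zero_exists:
  fixes F :: "'a::complete_space \<Rightarrow> 'a set"
  assumes limit: "infdist_limit_condition F"
    and \<alpha>: "\<alpha> \<ge> 0" and \<epsilon>: "\<epsilon> \<ge> 0" and "\<alpha> + \<epsilon> < 1"
    and step: "\<And>x. \<exists>y\<in>F x. infdist y (F y) \<le> \<alpha> * dist y x \<and>
      \<alpha> * dist y x \<le> (\<alpha> + \<epsilon>) * infdist x (F x)"
  shows "\<exists>x. infdist x (F x) = 0"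
proof (cases "\<alpha> = 0")
  case True
  then obtain y where "infdist y (F y) \<le> 0"
    using step by auto
  then show ?thesis
    using infdist_nonneg[of y "F y"] by (intro exI[of _ y]) linarith
next
  case False
  with \<alpha> have "\<alpha> > 0"
    by simp
  have "\<exists>y. infdist y (F y) \<le> (\<alpha> + \<epsilon>) * infdist x (F x) \<and>
      dist y x \<le> (\<alpha> + \<epsilon>) / \<alpha> * infdist x (F x)" for x
  proof -
    obtain y where "infdist y (F y) \<le> \<alpha> * dist y x"
      and "\<alpha> * dist y x \<le> (\<alpha> + \<epsilon>) * infdist x (F x)"
      using step by blast
    then show ?thesis
      using \<open>\<alpha> > 0\<close> by (intro exI[of _ y]) (simp add: field_simps)
  qed
  then obtain u x where "u \<longlonglongrightarrow> x" and "(\<lambda>n. infdist (u n) (F (u n))) \<longlonglongrightarrow> 0"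
    by (rule geometric_descent_converges[where \<delta> = "\<lambda>x. infdist x (F x)", rotated 4])
      (use \<alpha> \<epsilon> \<open>\<alpha> + \<epsilon> < 1\<close> in \<open>auto simp: infdist_nonneg\<close>)
  then show ?thesis
    using limit unfolding infdist_limit_condition_def by blast
qed

theorem theorem1p4:
  fixes F :: "'a::complete_space \<Rightarrow> 'a set"
  assumes nonempty: "\<And>x. F x \<noteq> {}"
    and closed_values: "\<And>x. closed (F x)"
  shows "(closed (mv_graph F) \<longrightarrow> infdist_limit_condition F) \<and>
    (infdist_limit_condition F \<and>
      (\<exists>\<alpha> \<epsilon> :: real. \<alpha> \<ge> 0 \<and> \<epsilon> \<ge> 0 \<and> \<alpha> + \<epsilon> < 1 \<and>
        (\<forall>x. \<exists>y\<in>F x. infdist y (F y) \<le> \<alpha> * dist y x \<and>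
           \<alpha> * dist y x \<le> (\<alpha> + \<epsilon>) * infdist x (F x)))
     \<longrightarrow> (\<exists>x. fixed_point F x))"
proof (intro conjI impI)
  assume "closed (mv_graph F)"
  with nonempty show "infdist_limit_condition F"
    by (rule closed_graph_imp_infdist_limit_condition)
next
  assume "infdist_limit_condition F \<and>
    (\<exists>\<alpha> \<epsilon> :: real. \<alpha> \<ge> 0 \<and> \<epsilon> \<ge> 0 \<and> \<alpha> + \<epsilon> < 1 \<and>
      (\<forall>x. \<exists>y\<in>F x. infdist y (F y) \<le> \<alpha> * dist y x \<and>
         \<alpha> * dist y x \<le> (\<alpha> + \<epsilon>) * infdist x (F x)))"
  then obtain \<alpha> \<epsilon> :: real where "infdist_limit_condition F" "\<alpha> \<ge> 0" "\<epsilon> \<ge> 0" "\<alpha> + \<epsilon> < 1"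
    and "\<And>x. \<exists>y\<in>F x. infdist y (F y) \<le> \<alpha> * dist y x \<and>
      \<alpha> * dist y x \<le> (\<alpha> + \<epsilon>) * infdist x (F x)"
    by (elim conjE exE) blast
  then obtain x where "infdist x (F x) = 0"
    using infdist_zero_exists by blast
  then have "fixed_point F x"
    unfolding fixed_point_def using in_closed_iff_infdist_zero[OF closed_values nonempty] by blast
  then show "\<exists>x. fixed_point F x" ..
qed

end
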